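(* Let $q=3^h$ with $h\ge2$, let $\psi(u)=\exp(2\pi i\operatorname{Tr}_{\mathbb F_q/\mathbb F_3}(u)/3)$, and let $$F(u)=\gamma\psi(u)+\overline\gamma\psi(-u)\quad(u\in\mathbb F_q),\qquad\gamma=\rho e^{i\theta}\ne0\quad(\rho>0,\ \theta\in\mathbb R).$$ Let $F_0,F_1,F_2$ be the (real) values of $F$ on the trace classes $\operatorname{Tr}_{\mathbb F_q/\mathbb F_3}=0,1,2$, put $a=q/3$, $N=2\rho^2(q-2\cos^2\theta)$ (the squared norm of $F|_{\mathbb F_q^\times}$), let $\phi=F|_{\mathbb F_q^\times}/\sqrt N$, and define $$\begin{aligned}A&=a(F_0^4+F_1^4+F_2^4)-F_0^4,\\ B&=(a-1)F_0^4+2aF_1^2F_2^2,\\ C&=\frac a3(F_0^2+F_1^2+F_2^2)^2-F_0^4.\end{aligned}$$ Put $\kappa=\cos(4\theta)$ and $Q=16\rho^4\cos^4\theta$, and let $\mu_-$ denote the smaller eigenvalue of the real symmetric matrix $$\frac1{N^2}\begin{pmatrix}2q\rho^4(2+\kappa)-Q&\sqrt{q-3}\,(2q\rho^4-Q)\\ \sqrt{q-3}\,(2q\rho^4-Q)&2q\rho^4(q-2+\kappa)-(q-3)Q\end{pmatrix}.$$ Then $$\sigma_{\min}(\mathcal M_\phi)^2=q\min\left\{\frac{A-C-|B-C|}{N^2},\ \frac{4q\rho^4}{N^2}\min\{\sin^2(2\theta),\cos^2(2\theta)\},\ \mu_-\right\}.$$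
   Context: $G_q=\mathbb F_q\rtimes\mathbb F_q^\times$ is the affine group with product $(k,l)(k',l')=(k+lk',ll')$, acting on $\mathbb C^{\mathbb F_q^\times}$ by the unitary representation $(\pi_q(k,l)f)(m)=\psi_0(km)f(lm)$, where $\psi_0$ is any fixed nontrivial additive character of $\mathbb F_q$. For a vector $\phi$, $\mathcal M_\phi:\mathbb C^{\mathbb F_q^\times\times\mathbb F_q^\times}\to\mathbb C^{G_q}$ is the linear map $\mathcal M_\phi(M)(g)=\langle M\pi_q(g)\phi,\pi_q(g)\phi\rangle$, and $\sigma_{\min}(\mathcal M_\phi)=\min_{M\ne0}\|\mathcal M_\phi(M)\|_{\ell^2(G_q)}/\|M\|_F$ (Frobenius norm; counting measure on $G_q$). *)

theory Defs
  imports "HOL-Analysis.Analysis"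
begin

typedef (overloaded) 'a nonzero = "{x :: 'a :: field. x \<noteq> 0}"
  morphisms val_nz Abs_nz
  by (rule exI[of _ 1]) simp

instance nonzero :: ("{field, finite}") finite
proof
  have "finite (range (val_nz :: 'a nonzero \<Rightarrow> 'a))" by simp
  then show "finite (UNIV :: 'a nonzero set)"
    by (rule finite_imageD) (simp add: inj_on_def val_nz_inject)
qed

definition mult_nz :: "'a::field nonzero \<Rightarrow> 'a nonzero \<Rightarrow> 'a nonzero" where
  "mult_nz l m = Abs_nz (val_nz l * val_nz m)"

lemma val_mult_nz: "val_nz (mult_nz l m) = val_nz l * val_nz m"
  unfolding mult_nz_def using val_nz[of l] val_nz[of m] by (simp add: Abs_nz_inverse)

text \<open>The affine group: its underlying set is the full type of pairs \<open>(k, l)\<close>.\<close>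

type_synonym 'a affine = "'a \<times> 'a nonzero"

definition affine_mult :: "'a::field affine \<Rightarrow> 'a affine \<Rightarrow> 'a affine" where
  "affine_mult g g' = (fst g + val_nz (snd g) * fst g', mult_nz (snd g) (snd g'))"

definition nontrivial_additive_character :: "('a::field \<Rightarrow> complex) \<Rightarrow> bool" where
  "nontrivial_additive_character \<psi> \<longleftrightarrow>
     (\<forall>x y. \<psi> (x + y) = \<psi> x * \<psi> y) \<and> (\<forall>x. norm (\<psi> x) = 1) \<and> (\<exists>x. \<psi> x \<noteq> 1)"

definition affine_rep ::
    "('a::{field,finite} \<Rightarrow> complex) \<Rightarrow> 'a affine \<Rightarrow> complex ^ 'a nonzero \<Rightarrow> complex ^ 'a nonzero" where
  "affine_rep \<psi>\<^sub>0 g f = (\<chi> m. \<psi>\<^sub>0 (fst g * val_nz m) * f $ mult_nz (snd g) m)"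

lemma affine_rep_mult:
  assumes "nontrivial_additive_character \<psi>\<^sub>0"
  shows "affine_rep \<psi>\<^sub>0 (affine_mult g g') f = affine_rep \<psi>\<^sub>0 g (affine_rep \<psi>\<^sub>0 g' f)"
proof -
  have *: "mult_nz (mult_nz l l') m = mult_nz l' (mult_nz l m)" for l l' m :: "'a nonzero"
    by (simp add: val_nz_inject[symmetric] val_mult_nz mult_ac)
  have "\<psi>\<^sub>0 (x + y) = \<psi>\<^sub>0 x * \<psi>\<^sub>0 y" for x y
    using assms by (simp add: nontrivial_additive_character_def)
  then show ?thesis
    by (simp add: affine_rep_def affine_mult_def vec_eq_iff val_mult_nz * algebra_simps)
qed

text \<open>Linear in the first argument; the library's \<open>inner\<close> on complex vectors is only the real part.\<close>

definition hermitian_inner :: "complex ^ 'n::finite \<Rightarrow> complex ^ 'n \<Rightarrow> complex" where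
  "hermitian_inner x y = (\<Sum>m\<in>UNIV. x $ m * cnj (y $ m))"

definition measurement_map ::
    "('a::{field,finite} \<Rightarrow> complex) \<Rightarrow> complex ^ 'a nonzero
      \<Rightarrow> complex ^ 'a nonzero ^ 'a nonzero \<Rightarrow> complex ^ 'a affine" where
  "measurement_map \<psi>\<^sub>0 \<phi> M =
     (\<chi> g. hermitian_inner (M *v affine_rep \<psi>\<^sub>0 g \<phi>) (affine_rep \<psi>\<^sub>0 g \<phi>))"

text \<open>The norm of a nested vector type is the Frobenius norm, and that of \<open>complex ^ 'g\<close> is the
  \<open>\<ell>\<^sup>2\<close> norm for the counting measure. The minimum is attained by compactness.\<close>

definition sigma_min :: "(complex ^ 'n::finite ^ 'n \<Rightarrow> complex ^ 'g::finite) \<Rightarrow> real" where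
  "sigma_min L = (LEAST s. \<exists>M. M \<noteq> 0 \<and> s = norm (L M) / norm M)"

definition trace_F3 :: "nat \<Rightarrow> 'a::field \<Rightarrow> 'a" where
  "trace_F3 h u = (\<Sum>i<h. u ^ (3 ^ i))"

text \<open>In a field of order \<open>3 ^ h\<close> the trace lies in the prime field, so it is the image of a
  unique \<open>j \<in> {0, 1, 2}\<close>.\<close>

definition trace_class :: "nat \<Rightarrow> 'a::field \<Rightarrow> nat" where
  "trace_class h u = (THE j. j < 3 \<and> of_nat j = trace_F3 h u)"

definition trace_character :: "nat \<Rightarrow> 'a::field \<Rightarrow> complex" where
  "trace_character h u = exp (2 * of_real pi * \<i> * of_nat (trace_class h u) / 3)"

definition trace_class_value :: "nat \<Rightarrow> ('a::field \<Rightarrow> complex) \<Rightarrow> nat \<Rightarrow> real" where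
  "trace_class_value h F j = (THE r. \<forall>u. trace_class h u = j \<longrightarrow> F u = of_real r)"

definition eigenvalues :: "real ^ 'n ^ 'n::finite \<Rightarrow> real set" where
  "eigenvalues A = {\<mu>. \<exists>v. v \<noteq> 0 \<and> A *v v = \<mu> *s v}"

end

theory Submission
  imports Defs "HOL-Computational_Algebra.Polynomial"
begin

text \<open>
  Parseval for \<open>\<psi>\<^sub>0\<close> in the translation variable \<open>k\<close> splits \<open>\<parallel>\<M>\<^sub>\<phi>(M)\<parallel>\<^sup>2\<close> into independent contributions
  of the diagonals \<open>n - m = d\<close> of \<open>M\<close>. In characteristic 3 the pairs \<open>(m, n)\<close> are \<open>(d - s, - d - s)\<close> with
  \<open>s = m + n\<close>, and \<open>F(l m) F(l n)\<close> is a combination of \<open>\<psi>(\<plusminus> l s)\<close> and \<open>\<psi>(\<plusminus> l d)\<close>. A second Parseval, for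
  \<open>\<psi>\<close> in \<open>l\<close> and corrected by the missing \<open>l = 0\<close>, turns the contribution of
  the diagonal \<open>v\<close> into
  \<open>q \<Sum>\<^sub>s \<bar>\<gamma>\<^sup>2 v(s) + \<gamma>'\<^sup>2 v(- s)\<bar>\<^sup>2 + (e q \<rho>\<^sup>4 - Q) \<bar>\<Sum>\<^sub>s v(s)\<bar>\<^sup>2\<close>, where \<open>\<gamma>'\<close> is the conjugate of \<open>\<gamma>\<close>,
  \<open>e = 4\<close> for \<open>d = 0\<close> and \<open>e = 2\<close> otherwise. The last coefficient is nonnegative because
  \<open>q \<ge> 9\<close> and \<open>Q \<le> 16 \<rho>\<^sup>4\<close>, and the first sum is diagonalised by even and odd vectors, with eigenvalues
  \<open>4 \<rho>\<^sup>4 cos\<^sup>2 2\<theta>\<close> and \<open>4 \<rho>\<^sup>4 sin\<^sup>2 2\<theta>\<close>. Since vectors of sum zero of both parities exist for \<open>d \<noteq> 0\<close>,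
  the minimum is governed by the middle one of the three terms alone: the first term equals it,
  and \<open>\<mu>\<close> is exactly \<open>4 q \<rho>\<^sup>4 cos\<^sup>2 2\<theta> / N\<^sup>2\<close>.
\<close>

section \<open>The trace character of a field of order $3^h$\<close>

lemma of_nat_card_eq_0: "of_nat CARD('a) = (0 :: 'a::{field,finite})"
proof -
  have "(\<Sum>x\<in>UNIV. x) = (\<Sum>x\<in>UNIV. x + (1 :: 'a))"
    by (rule sum.reindex_bij_witness[of _ "\<lambda>x. x + 1" "\<lambda>x. x - 1"]) auto
  then show ?thesis
    by (simp add: sum.distrib)
qed

text \<open>Multiplication by a nonzero \<open>x\<close> permutes the nonzero elements, so their
  product absorbs the factor \<open>x ^ (CARD('a) - 1)\<close>.\<close>

lemma power_card_eq_self: "x ^ CARD('a) = (x :: 'a::{field,finite})"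
proof (cases "x = 0")
  case True
  then show ?thesis by (simp add: power_0_left)
next
  case False
  let ?P = "\<Prod>y\<in>UNIV - {0}. y :: 'a"
  have "?P = (\<Prod>y\<in>UNIV - {0}. x * y)"
    by (rule prod.reindex_bij_witness[of _ "\<lambda>y. x * y" "\<lambda>y. y / x"]) (use False in auto)
  also have "\<dots> = x ^ (CARD('a) - 1) * ?P"
    by (simp add: prod.distrib card_Diff_singleton)
  finally have "x ^ (CARD('a) - 1) = 1"
    by simp
  then have "x * x ^ (CARD('a) - 1) = x"
    by simp
  then show ?thesis
    by (simp flip: power_Suc)
qed

lemma three_eq_0:
  assumes "CARD('a::{field,finite}) = 3 ^ h"
  shows "(3 :: 'a) = 0"
proof -
  have "of_nat (3 ^ h) = (0 :: 'a)"
    using of_nat_card_eq_0[where 'a = 'a] by (simp only: assms)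
  then show ?thesis
    by simp
qed

lemma char_3:
  assumes "(3 :: 'a::field) = 0"
  shows "(2 :: 'a) = - 1" and "- 2 = (1 :: 'a)" and "(2 :: 'a) \<noteq> 0" and "(2 :: 'a) \<noteq> 1"
proof -
  show *: "(2 :: 'a) = - 1"
    using assms by (simp add: eq_neg_iff_add_eq_0)
  show "- 2 = (1 :: 'a)"
    unfolding * by simp
  show "(2 :: 'a) \<noteq> 0"
    unfolding * by simp
  show "(2 :: 'a) \<noteq> 1"
    unfolding one_add_one[symmetric] add_cancel_left_left by simp
qed

lemma of_nat_eq_iff_mod_3:
  assumes "(3 :: 'a::field) = 0"
  shows "of_nat m = (of_nat n :: 'a) \<longleftrightarrow> m mod 3 = n mod 3"
proof -
  have red: "of_nat k = (of_nat (k mod 3) :: 'a)" for k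
  proof -
    have "of_nat k = (of_nat (3 * (k div 3) + k mod 3) :: 'a)"
      by simp
    also have "\<dots> = of_nat (k mod 3)"
      unfolding of_nat_add of_nat_mult using assms by simp
    finally show ?thesis .
  qed
  note neq = char_3(3,4)[OF assms] char_3(3,4)[OF assms, symmetric]
  have *: "of_nat i = (of_nat j :: 'a) \<longleftrightarrow> i = j" if "i < 3" "j < 3" for i j
  proof -
    have "i = 0 \<or> i = 1 \<or> i = 2" "j = 0 \<or> j = 1 \<or> j = 2"
      using that by linarith+
    then show ?thesis
      by (elim disjE) (simp_all add: neq)
  qed
  show ?thesis
    unfolding red[of m] red[of n] by (intro *) simp_all
qed

text \<open>Iterated Frobenius: the mixed terms of a cube carry a factor 3.\<close>

lemma power_3_power_add:
  assumes "(3 :: 'a::field) = 0"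
  shows "(x + y :: 'a) ^ (3 ^ i) = x ^ (3 ^ i) + y ^ (3 ^ i)"
proof (induction i)
  case (Suc i)
  have "(u + v :: 'a) ^ 3 = u ^ 3 + v ^ 3 + 3 * (u\<^sup>2 * v + u * v\<^sup>2)" for u v
    by (simp add: power2_eq_square power3_eq_cube algebra_simps)
  then have "(u + v :: 'a) ^ 3 = u ^ 3 + v ^ 3" for u v
    by (simp add: assms)
  then show ?case
    by (simp add: power_mult mult.commute[of 3] Suc)
qed simp

section \<open>The absolute trace and its classes\<close>

lemma trace_F3_add:
  assumes "(3 :: 'a::field) = 0"
  shows "trace_F3 h (x + y :: 'a) = trace_F3 h x + trace_F3 h y"
  by (simp add: trace_F3_def power_3_power_add[OF assms] sum.distrib)

lemma sum_power_3:
  assumes "(3 :: 'a::field) = 0"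
  shows "(\<Sum>i\<in>A. f i :: 'a) ^ 3 = (\<Sum>i\<in>A. f i ^ 3)"
  by (induction A rule: infinite_finite_induct)
    (use power_3_power_add[OF assms, of _ _ 1] in auto)

text \<open>Cubing shifts every exponent one place; the term \<open>u ^ 3 ^ h\<close> entering at
  the top equals the term \<open>u\<close> lost at the bottom.\<close>

lemma trace_F3_cube:
  assumes "CARD('a::{field,finite}) = 3 ^ h"
  shows "trace_F3 h (u :: 'a) ^ 3 = trace_F3 h u"
proof -
  have "trace_F3 h u ^ 3 = (\<Sum>i<h. u ^ 3 ^ Suc i)"
    by (simp add: trace_F3_def sum_power_3[OF three_eq_0[OF assms]] mult.commute flip: power_mult)
  moreover have "(\<Sum>i<h. u ^ 3 ^ Suc i) + u = trace_F3 h u + u ^ 3 ^ h"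
    using sum.lessThan_Suc[of "\<lambda>i. u ^ 3 ^ i" h] sum.lessThan_Suc_shift[of "\<lambda>i. u ^ 3 ^ i" h]
    by (simp add: trace_F3_def add.commute)
  moreover have "u ^ 3 ^ h = u"
    using power_card_eq_self[of u] by (simp only: assms)
  ultimately show ?thesis
    by simp
qed

text \<open>The trace is a root of \<open>t * (t - 1) * (t + 1)\<close>, and \<open>- 1\<close> is
  the image of 2. This makes the \<open>THE\<close> in \<open>trace_class\<close> well
  defined.\<close>

lemma trace_class:
  assumes "CARD('a::{field,finite}) = 3 ^ h"
  shows "trace_class h (u :: 'a) < 3" and "of_nat (trace_class h u) = trace_F3 h u"
proof -
  note three = three_eq_0[OF assms]
  let ?t = "trace_F3 h u"
  have "?t * (?t - 1) * (?t + 1) = 0"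
    using trace_F3_cube[OF assms, of u] by (simp add: algebra_simps power3_eq_cube)
  then have "?t = of_nat 0 \<or> ?t = of_nat 1 \<or> ?t = - 1"
    by (simp add: eq_neg_iff_add_eq_0)
  moreover have "(- 1 :: 'a) = of_nat 2"
    using char_3(1)[OF three] by simp
  ultimately have "\<exists>j<3. of_nat j = ?t"
  proof (elim disjE)
    assume "?t = of_nat 0"
    then show ?thesis by (intro exI[of _ 0]) simp
  next
    assume "?t = of_nat 1"
    then show ?thesis by (intro exI[of _ 1]) simp
  next
    assume "?t = - 1"
    then show ?thesis using \<open>- 1 = of_nat 2\<close> by (intro exI[of _ 2]) simp
  qed
  then have "\<exists>!j. j < 3 \<and> of_nat j = ?t"
  proof (elim exE conjE, intro ex1I conjI)
    fix i j :: nat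
    assume "i < 3" "of_nat i = ?t" "j < 3 \<and> of_nat j = ?t"
    then show "j = i"
      using of_nat_eq_iff_mod_3[OF three, of j i] by simp
  qed
  from theI'[OF this] show "trace_class h u < 3" "of_nat (trace_class h u) = ?t"
    by (auto simp: trace_class_def)
qed

text \<open>The trace is a nonzero polynomial of degree at most \<open>3 ^ (h - 1)\<close>, so it
  has fewer roots than the field has elements.\<close>

lemma exists_trace_F3_nonzero:
  assumes "CARD('a::{field,finite}) = 3 ^ h" and "h > 0"
  shows "\<exists>u :: 'a. trace_F3 h u \<noteq> 0"
proof -
  define p where "p = (\<Sum>i<h. monom (1 :: 'a) (3 ^ i))"
  have "coeff p 1 = (\<Sum>i<h. if i = 0 then 1 else 0)"
    unfolding p_def coeff_sum by (intro sum.cong) auto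
  then have "p \<noteq> 0"
    using assms(2) by auto
  moreover have "degree p \<le> 3 ^ (h - 1)"
    unfolding p_def
    by (intro degree_sum_le) (auto intro!: order.trans[OF degree_monom_le] power_increasing)
  ultimately have "card {u. poly p u = 0} \<le> 3 ^ (h - 1)"
    using card_poly_roots_bound[of p] by simp
  also have "\<dots> < CARD('a)"
    using assms by simp
  finally have "{u. poly p u = 0} \<noteq> UNIV"
    by auto
  moreover have "poly p u = trace_F3 h u" for u
    by (simp add: p_def poly_sum poly_monom trace_F3_def)
  ultimately show ?thesis
    by auto
qed

lemma trace_class_surj:
  assumes card: "CARD('a::{field,finite}) = 3 ^ h" and "h > 0" and "j < 3"
  shows "\<exists>u :: 'a. trace_class h u = j"
proof -
  note three = three_eq_0[OF card]
  obtain c :: 'a where c: "trace_F3 h c \<noteq> 0"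
    using exists_trace_F3_nonzero[OF assms(1,2)] by blast
  define t where "t = trace_class h c"
  have "t \<noteq> 0" "t < 3"
    using c trace_class[OF card, of c] by (auto simp: t_def intro!: gr0I)
  have mult: "trace_F3 h (of_nat k * c) = of_nat (k * t)" for k
  proof (induction k)
    case 0
    have "trace_F3 h (0 :: 'a) + trace_F3 h 0 = trace_F3 h 0 + 0"
      using trace_F3_add[OF three, of h 0 0] by simp
    then show ?case
      by (simp only: add_left_cancel) simp
  next
    case (Suc k)
    then show ?case
      by (simp add: distrib_right trace_F3_add[OF three] t_def trace_class[OF card])
  qed
  \<comment> \<open>The class \<open>t\<close> is 1 or 2, hence its own inverse modulo 3; so the
    multiple \<open>j * t\<close> of \<open>c\<close> has class \<open>j\<close>.\<close>
  have "(j * t * t) mod 3 = j mod 3"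
  proof -
    have "t = 1 \<or> t = 2"
      using \<open>t \<noteq> 0\<close> \<open>t < 3\<close> by linarith
    then show ?thesis
      using mod_mult_self2[of j 3 j] by (elim disjE) simp_all
  qed
  moreover have "of_nat (trace_class h (of_nat (j * t) * c)) = (of_nat (j * t * t) :: 'a)"
    by (simp only: trace_class[OF card] mult)
  ultimately have "trace_class h (of_nat (j * t) * c) mod 3 = j mod 3"
    by (simp add: of_nat_eq_iff_mod_3[OF three] del: of_nat_mult)
  then show ?thesis
    using trace_class(1)[OF card] \<open>j < 3\<close> by (metis mod_less)
qed

lemma trace_character_eq: "trace_character h u = cis (2 * pi / 3) ^ trace_class h u"
  by (simp add: trace_character_def cis_conv_exp mult_ac flip: exp_of_nat_mult)

text \<open>Trace classes add only modulo 3, which suffices because \<open>cis (2 * pi / 3)\<close>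
  is a cube root of unity.\<close>

lemma nontrivial_trace_character:
  assumes card: "CARD('a::{field,finite}) = 3 ^ h" and "h > 0"
  shows "nontrivial_additive_character (trace_character h :: 'a \<Rightarrow> complex)"
  unfolding nontrivial_additive_character_def
proof (intro conjI allI)
  note three = three_eq_0[OF card]
  let ?w = "cis (2 * pi / 3)"
  have "?w ^ 3 = 1"
    by (subst Complex.DeMoivre) simp
  then have red: "?w ^ n = ?w ^ (n mod 3)" for n
    by (metis mult_div_mod_eq power_add power_mult power_one mult_1)
  show "trace_character h (x + y) = trace_character h x * trace_character h y" for x y :: 'a
  proof -
    have "of_nat (trace_class h (x + y)) = (of_nat (trace_class h x + trace_class h y) :: 'a)"
      by (simp add: trace_class[OF card] trace_F3_add[OF three])
    then have "trace_class h (x + y) mod 3 = (trace_class h x + trace_class h y) mod 3"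
      by (simp only: of_nat_eq_iff_mod_3[OF three])
    then show ?thesis
      unfolding trace_character_eq power_add[symmetric] by (metis red)
  qed
  show "norm (trace_character h x) = 1" for x :: 'a
    by (simp add: trace_character_eq norm_power)
  obtain u :: 'a where "trace_class h u = 1"
    using trace_class_surj[OF assms, of 1] by auto
  moreover have "sin (2 * pi / 3) \<noteq> 0"
    using sin_gt_zero[of "2 * pi / 3"] by simp
  then have "?w \<noteq> 1"
    by (auto simp: complex_eq_iff)
  ultimately show "\<exists>x :: 'a. trace_character h x \<noteq> 1"
    by (metis trace_character_eq power_one_right)
qed

section \<open>Decomposition of the measurement map along differences\<close>

lemma additive_character:
  assumes "nontrivial_additive_character \<eta>"
  shows character_add: "\<eta> (x + y) = \<eta> x * \<eta> y"
    and character_0: "\<eta> 0 = 1"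
    and character_minus: "\<eta> (- x) = cnj (\<eta> x)"
proof -
  have add: "\<eta> (x + y) = \<eta> x * \<eta> y" and norm: "norm (\<eta> x) = 1" for x y
    using assms by (auto simp: nontrivial_additive_character_def)
  show "\<eta> (x + y) = \<eta> x * \<eta> y"
    by (fact add)
  have "\<eta> 0 \<noteq> 0"
    using norm[of 0] by auto
  then show zero: "\<eta> 0 = 1"
    using add[of 0 0] by simp
  have "\<eta> x * \<eta> (- x) = \<eta> x * cnj (\<eta> x)"
    using add[of x "- x"] zero norm[of x] by (simp add: complex_norm_square[symmetric])
  moreover have "\<eta> x \<noteq> 0"
    using norm[of x] by auto
  ultimately show "\<eta> (- x) = cnj (\<eta> x)"
    by simp
qed

lemma character_diff:
  assumes "nontrivial_additive_character \<eta>"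
  shows "\<eta> (x - y) = \<eta> x * cnj (\<eta> y)"
  using character_add[OF assms, of x "- y"] by (simp add: character_minus[OF assms])

lemma character_orthogonality:
  fixes \<eta> :: "'a::{field,finite} \<Rightarrow> complex"
  assumes "nontrivial_additive_character \<eta>"
  shows "(\<Sum>k\<in>UNIV. \<eta> (k * x)) = (if x = 0 then of_nat CARD('a) else 0)"
proof (cases "x = 0")
  case True
  then show ?thesis
    by (simp add: character_0[OF assms])
next
  case False
  obtain u where u: "\<eta> u \<noteq> 1"
    using assms by (auto simp: nontrivial_additive_character_def)
  have "(\<Sum>k\<in>UNIV. \<eta> (k * x)) = (\<Sum>k\<in>UNIV. \<eta> k)"
    by (rule sum.reindex_bij_witness[of _ "\<lambda>k. k / x" "\<lambda>k. k * x"]) (use False in auto)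
  \<comment> \<open>Translation by \<open>u\<close> preserves the sum but multiplies it by
    \<open>\<eta> u\<close>, which is not 1, so the sum vanishes.\<close>
  moreover have "(\<Sum>k\<in>UNIV. \<eta> k) = \<eta> u * (\<Sum>k\<in>UNIV. \<eta> k)"
    unfolding sum_distrib_left character_add[OF assms, symmetric]
    by (rule sum.reindex_bij_witness[of _ "\<lambda>k. u + k" "\<lambda>k. k - u"]) auto
  ultimately show ?thesis
    using u False by simp
qed

lemma character_parseval:
  fixes \<eta> :: "'a::{field,finite} \<Rightarrow> complex"
  assumes "nontrivial_additive_character \<eta>"
  shows "(\<Sum>k\<in>UNIV. (norm (\<Sum>d\<in>UNIV. \<eta> (k * d) * c d))\<^sup>2) = CARD('a) * (\<Sum>d\<in>UNIV. (norm (c d))\<^sup>2)"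
proof -
  have "complex_of_real (\<Sum>k\<in>UNIV. (norm (\<Sum>d\<in>UNIV. \<eta> (k * d) * c d))\<^sup>2)
      = (\<Sum>k\<in>UNIV. \<Sum>d\<in>UNIV. \<Sum>e\<in>UNIV. \<eta> (k * (d - e)) * (c d * cnj (c e)))"
    unfolding of_real_sum complex_norm_square cnj_sum sum_product
    by (intro sum.cong refl)
      (simp add: right_diff_distrib character_diff[OF assms])
  also have "\<dots> = (\<Sum>d\<in>UNIV. \<Sum>e\<in>UNIV. \<Sum>k\<in>UNIV. \<eta> (k * (d - e)) * (c d * cnj (c e)))"
    by (rule trans[OF sum.swap]) (intro sum.cong refl sum.swap)
  also have "\<dots> = (\<Sum>d\<in>UNIV. \<Sum>e\<in>UNIV. if e = d then CARD('a) * (c d * cnj (c d)) else 0)"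
    by (intro sum.cong refl)
      (auto simp: sum_distrib_right[symmetric] character_orthogonality[OF assms])
  also have "\<dots> = of_real (CARD('a) * (\<Sum>d\<in>UNIV. (norm (c d))\<^sup>2))"
    unfolding of_real_mult of_real_sum complex_norm_square sum_distrib_left
    by simp
  finally show ?thesis
    unfolding of_real_eq_iff .
qed

section \<open>The energy of one diagonal\<close>

definition real_wave :: "complex \<Rightarrow> ('a::field \<Rightarrow> complex) \<Rightarrow> 'a \<Rightarrow> complex" where
  "real_wave \<gamma> \<psi> u = \<gamma> * \<psi> u + cnj \<gamma> * \<psi> (- u)"

lemma real_wave_conv_Re:
  assumes "nontrivial_additive_character \<psi>"
  shows "real_wave \<gamma> \<psi> u = of_real (2 * Re (\<gamma> * \<psi> u))"
proof -
  have "real_wave \<gamma> \<psi> u = \<gamma> * \<psi> u + cnj (\<gamma> * \<psi> u)"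
    by (simp add: real_wave_def character_minus[OF assms])
  then show ?thesis
    by (simp only: complex_add_cnj)
qed

text \<open>On a fixed diagonal \<open>x - y\<close> is constant, so the cross terms will factor
  out; only the first two terms see the position \<open>x + y\<close>.\<close>

lemma real_wave_mult:
  fixes \<psi> :: "'a::field \<Rightarrow> complex"
  assumes "nontrivial_additive_character \<psi>"
  shows "real_wave \<gamma> \<psi> x * real_wave \<gamma> \<psi> y
    = \<gamma>\<^sup>2 * \<psi> (x + y) + (cnj \<gamma>)\<^sup>2 * \<psi> (- (x + y)) + (norm \<gamma>)\<^sup>2 * (\<psi> (x - y) + \<psi> (- (x - y)))"
  unfolding real_wave_def complex_norm_square diff_conv_add_uminus minus_add_distrib
    character_add[OF assms] minus_minus
  by (simp add: power2_eq_square algebra_simps)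

text \<open>Here \<open>v\<close> lives on the whole field, including positions where a matrix index
  would be 0, so that Fourier analysis on the additive group applies.\<close>

definition sector_energy :: "('a::{field,finite} \<Rightarrow> complex) \<Rightarrow> 'a \<Rightarrow> ('a \<Rightarrow> complex) \<Rightarrow> real" where
  "sector_energy F d v = (\<Sum>l\<in>- {0}. (norm (\<Sum>s\<in>UNIV. v s * (F (l * (d - s)) * F (l * (- d - s)))))\<^sup>2)"

text \<open>As a function of \<open>l\<close> the inner sum is the Fourier transform of
  \<open>w\<close>, which is \<open>u\<close> plus point masses at \<open>d\<close> and
  \<open>- d\<close>. Since \<open>v\<close> vanishes there, the two parts have disjoint supports
  and their squared norms add.\<close>

lemma sector_energy_real_wave:
  fixes \<psi> :: "'a::{field,finite} \<Rightarrow> complex"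
  assumes \<psi>: "nontrivial_additive_character \<psi>" and three: "(3 :: 'a) = 0"
    and v: "v d = 0" "v (- d) = 0"
  shows "sector_energy (real_wave \<gamma> \<psi>) d v
    = CARD('a) * (\<Sum>s\<in>UNIV. (norm (\<gamma>\<^sup>2 * v s + (cnj \<gamma>)\<^sup>2 * v (- s)))\<^sup>2)
      + ((if d = 0 then 4 else 2) * CARD('a) * norm \<gamma> ^ 4 - (2 * Re \<gamma>) ^ 4) * (norm (\<Sum>s\<in>UNIV. v s))\<^sup>2"
proof -
  define \<sigma> where "\<sigma> = (\<Sum>s\<in>UNIV. v s)"
  define u where "u s = \<gamma>\<^sup>2 * v s + (cnj \<gamma>)\<^sup>2 * v (- s)" for s
  define e :: "'a \<Rightarrow> real" where "e s = of_bool (s = d) + of_bool (s = - d)" for s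
  define w where "w s = u s + (norm \<gamma>)\<^sup>2 * \<sigma> * e s" for s
  let ?H = "\<lambda>l. \<Sum>s\<in>UNIV. v s * (real_wave \<gamma> \<psi> (l * (d - s)) * real_wave \<gamma> \<psi> (l * (- d - s)))"
  have H: "?H l = (\<Sum>s\<in>UNIV. \<psi> (l * s) * w s)" for l
  proof -
    have "l * (d - s) + l * (- d - s) = - (2 * (l * s))" "l * (d - s) - l * (- d - s) = 2 * (l * d)" for s
      by (simp_all add: algebra_simps)
    \<comment> \<open>Characteristic 3 turns \<open>- 2\<close> into 1 and 2 into
      \<open>- 1\<close>.\<close>
    then have arg: "l * (d - s) + l * (- d - s) = l * s" "l * (d - s) - l * (- d - s) = - (l * d)" for s
      by (simp_all only: char_3(1)[OF three]) simp_all
    have "?H l = (\<Sum>s\<in>UNIV. \<gamma>\<^sup>2 * v s * \<psi> (l * s)) + (\<Sum>s\<in>UNIV. (cnj \<gamma>)\<^sup>2 * v s * \<psi> (- (l * s)))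
        + (norm \<gamma>)\<^sup>2 * \<sigma> * (\<psi> (l * d) + \<psi> (- (l * d)))"
      unfolding real_wave_mult[OF \<psi>] arg \<sigma>_def sum_distrib_left sum_distrib_right sum.distrib[symmetric]
      by (intro sum.cong refl) (simp add: algebra_simps)
    also have "(\<Sum>s\<in>UNIV. (cnj \<gamma>)\<^sup>2 * v s * \<psi> (- (l * s))) = (\<Sum>s\<in>UNIV. (cnj \<gamma>)\<^sup>2 * v (- s) * \<psi> (l * s))"
      by (rule sum.reindex_bij_witness[of _ uminus uminus]) auto
    also have "(norm \<gamma>)\<^sup>2 * \<sigma> * (\<psi> (l * d) + \<psi> (- (l * d))) = (\<Sum>s\<in>UNIV. (norm \<gamma>)\<^sup>2 * \<sigma> * e s * \<psi> (l * s))"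
    proof -
      have "(\<Sum>s\<in>UNIV. e s * \<psi> (l * s))
          = (\<Sum>s\<in>UNIV. (if s = d then \<psi> (l * d) else 0) + (if s = - d then \<psi> (- (l * d)) else 0))"
        by (intro sum.cong refl) (auto simp: e_def distrib_right char_3(3)[OF three])
      then show ?thesis
        by (simp add: sum.distrib mult.assoc flip: sum_distrib_left)
    qed
    finally show ?thesis
      unfolding sum.distrib[symmetric]
      by (rule trans) (intro sum.cong refl, simp add: w_def u_def algebra_simps)
  qed
  \<comment> \<open>The energy omits \<open>l = 0\<close>; restoring and subtracting that term
    allows Parseval on the full group.\<close>
  have "sector_energy (real_wave \<gamma> \<psi>) d v = (\<Sum>l\<in>UNIV. (norm (?H l))\<^sup>2) - (norm (?H 0))\<^sup>2"
    unfolding sector_energy_def Compl_eq_Diff_UNIV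
    using sum.remove[of UNIV 0 "\<lambda>l. (norm (?H l))\<^sup>2"] by (simp only: finite_class.finite UNIV_I)
  also have "(\<Sum>l\<in>UNIV. (norm (?H l))\<^sup>2) = CARD('a) * (\<Sum>s\<in>UNIV. (norm (w s))\<^sup>2)"
    unfolding H by (rule character_parseval[OF \<psi>])
  also have "(\<Sum>s\<in>UNIV. (norm (w s))\<^sup>2)
      = (\<Sum>s\<in>UNIV. (norm (u s))\<^sup>2) + norm \<gamma> ^ 4 * (norm \<sigma>)\<^sup>2 * (\<Sum>s\<in>UNIV. (e s)\<^sup>2)"
  proof -
    have "(norm (w s))\<^sup>2 = (norm (u s))\<^sup>2 + norm \<gamma> ^ 4 * (norm \<sigma>)\<^sup>2 * (e s)\<^sup>2" for s
    proof (cases "s = d \<or> s = - d")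
      case True
      then have "u s = 0"
        using v by (auto simp: u_def)
      then show ?thesis
        by (simp add: w_def norm_mult norm_power power_mult_distrib)
    qed (simp add: w_def e_def)
    then show ?thesis
      by (simp add: sum.distrib sum_distrib_left)
  qed
  also have "(\<Sum>s\<in>UNIV. (e s)\<^sup>2) = (if d = 0 then 4 else 2)"
  proof -
    have "d = - d \<longleftrightarrow> d = 0"
      by (simp add: char_3(3)[OF three])
    \<comment> \<open>For \<open>d = 0\<close> the point masses coincide: \<open>e\<close> is 2
      there, and its square is split as 3 + 1.\<close>
    then have "(e s)\<^sup>2 = (if s = d then if d = 0 then 3 else 1 else 0) + (if s = - d then 1 else 0)" for s
      by (auto simp: e_def power2_eq_square)
    then show ?thesis
      by (simp add: sum.distrib)
  qed
  also have "?H 0 = of_real ((2 * Re \<gamma>)\<^sup>2) * \<sigma>"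
  proof -
    have "real_wave \<gamma> \<psi> 0 = of_real (2 * Re \<gamma>)"
      by (simp add: real_wave_conv_Re[OF \<psi>] character_0[OF \<psi>])
    then show ?thesis
      by (simp only: mult_zero_left sum_distrib_right[symmetric] \<sigma>_def[symmetric] power2_eq_square
          of_real_mult mult.commute[of \<sigma>])
  qed
  also have "(norm (of_real ((2 * Re \<gamma>)\<^sup>2) * \<sigma>))\<^sup>2 = (2 * Re \<gamma>) ^ 4 * (norm \<sigma>)\<^sup>2"
    unfolding norm_mult power_mult_distrib norm_of_real power2_abs by simp
  finally show ?thesis
    unfolding u_def \<sigma>_def by (simp only: left_diff_distrib distrib_left) simp
qed

section \<open>Coordinates along the diagonals of a matrix\<close>

definition zero_extension :: "complex ^ 'a::{field,finite} nonzero ^ 'a nonzero \<Rightarrow> 'a \<Rightarrow> 'a \<Rightarrow> complex" where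
  "zero_extension M x y = (if x = 0 \<or> y = 0 then 0 else M $ Abs_nz x $ Abs_nz y)"

text \<open>In characteristic 3 the substitution \<open>x = d - s\<close>,
  \<open>y = - d - s\<close> has inverse \<open>d = y - x\<close>, \<open>s = x + y\<close>:
  \<open>d\<close> labels the diagonal and \<open>s\<close> the position on it.\<close>

definition sector :: "complex ^ 'a::{field,finite} nonzero ^ 'a nonzero \<Rightarrow> 'a \<Rightarrow> 'a \<Rightarrow> complex" where
  "sector M d s = zero_extension M (d - s) (- d - s)"

text \<open>At these positions one index becomes 0. This supplies the vanishing hypotheses of
  \<open>sector_energy_ge\<close>.\<close>

lemma sector_boundary: "sector M d d = 0" "sector M d (- d) = 0"
  by (simp_all add: sector_def zero_extension_def)

lemma val_nz_neq_0: "val_nz m \<noteq> 0"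
  using val_nz[of m] by simp

lemma sum_nonzero: "(\<Sum>m\<in>UNIV. f (val_nz m)) = (\<Sum>x\<in>- {0 :: 'a::{field,finite}}. f x)"
  by (rule sum.reindex_bij_witness[of _ Abs_nz val_nz])
    (simp_all add: val_nz_inverse Abs_nz_inverse val_nz_neq_0)

text \<open>Zero extension lets both indices run over the whole field, where the linear change of
  coordinates is a bijection; the condition on \<open>H\<close> discards the added pairs. A general
  \<open>H\<close> serves both the Frobenius norm and the entries of the measurement map.\<close>

lemma sum_nonzero_pairs:
  fixes M :: "complex ^ 'a::{field,finite} nonzero ^ 'a nonzero" and H :: "'a \<Rightarrow> 'a \<Rightarrow> complex \<Rightarrow> 'b::comm_monoid_add"
  assumes three: "(3 :: 'a) = 0" and H: "\<And>x y. H x y 0 = 0"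
  shows "(\<Sum>m\<in>UNIV. \<Sum>n\<in>UNIV. H (val_nz m) (val_nz n) (M $ m $ n))
    = (\<Sum>d\<in>UNIV. \<Sum>s\<in>UNIV. H (d - s) (- d - s) (sector M d s))"
proof -
  let ?f = "\<lambda>x y. H x y (zero_extension M x y)"
  have "(\<Sum>m\<in>UNIV. \<Sum>n\<in>UNIV. H (val_nz m) (val_nz n) (M $ m $ n))
      = (\<Sum>m\<in>UNIV. \<Sum>n\<in>UNIV. ?f (val_nz m) (val_nz n))"
    by (simp add: zero_extension_def val_nz_inverse val_nz_neq_0)
  also have "\<dots> = (\<Sum>x\<in>- {0}. \<Sum>y\<in>- {0}. ?f x y)"
    by (simp only: sum_nonzero[of "\<lambda>y. ?f _ y"] sum_nonzero[of "\<lambda>x. \<Sum>y\<in>- {0}. ?f x y"])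
  also have "\<dots> = (\<Sum>x\<in>- {0}. \<Sum>y\<in>UNIV. ?f x y)"
    by (intro sum.cong sum.mono_neutral_left refl) (auto simp: zero_extension_def H)
  also have "\<dots> = (\<Sum>x\<in>UNIV. \<Sum>y\<in>UNIV. ?f x y)"
    by (intro sum.mono_neutral_left) (auto simp: zero_extension_def H)
  also have "\<dots> = (\<Sum>(x, y)\<in>UNIV \<times> UNIV. ?f x y)"
    by (simp add: sum.cartesian_product)
  also have "\<dots> = (\<Sum>(d, s)\<in>UNIV \<times> UNIV. ?f (d - s) (- d - s))"
  proof (rule sum.reindex_bij_witness[of _ "\<lambda>(d, s). (d - s, - d - s)" "\<lambda>(x, y). (y - x, x + y)"])
    fix p :: "'a \<times> 'a"
    have "- d - s - (d - s) = - 2 * d" "d - s + (- d - s) = - 2 * s" for d s :: 'a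
      by (simp_all add: algebra_simps)
    then show "(case case p of (d, s) \<Rightarrow> (d - s, - d - s) of (x, y) \<Rightarrow> (y - x, x + y)) = p"
      by (cases p) (simp only: prod.case char_3(2)[OF three] mult_1)
    have "y - x - (x + y) = - 2 * x" "- (y - x) - (x + y) = - 2 * y" for x y :: 'a
      by (simp_all add: algebra_simps)
    then have inv: "y - x - (x + y) = x" "- (y - x) - (x + y) = y" for x y :: 'a
      by (simp_all only: char_3(2)[OF three] mult_1)
    then show "(case case p of (x, y) \<Rightarrow> (y - x, x + y) of (d, s) \<Rightarrow> (d - s, - d - s)) = p"
      by (cases p) (simp only: prod.case)
    show "(case case p of (x, y) \<Rightarrow> (y - x, x + y) of (d, s) \<Rightarrow> ?f (d - s) (- d - s)) = (case p of (x, y) \<Rightarrow> ?f x y)"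
      by (cases p) (simp only: prod.case inv)
  qed simp_all
  finally show ?thesis
    by (simp add: sum.cartesian_product sector_def)
qed

lemma norm_vec_square: "(norm x)\<^sup>2 = (\<Sum>i\<in>UNIV. (norm (x $ i))\<^sup>2)"
  by (simp add: norm_vec_def L2_set_def sum_nonneg)

lemma norm_matrix_square:
  fixes M :: "complex ^ 'a::{field,finite} nonzero ^ 'a nonzero"
  assumes "(3 :: 'a) = 0"
  shows "(norm M)\<^sup>2 = (\<Sum>d\<in>UNIV. \<Sum>s\<in>UNIV. (norm (sector M d s))\<^sup>2)"
  unfolding norm_vec_square
  by (rule sum_nonzero_pairs[OF assms, where H = "\<lambda>_ _ z. (norm z)\<^sup>2"]) simp

text \<open>For fixed \<open>l\<close> the entry at \<open>(k, l)\<close> is a Fourier sum in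
  \<open>k\<close> with one coefficient per diagonal; Parseval removes the interference between
  diagonals.\<close>

lemma norm_measurement_square:
  fixes \<eta> :: "'a::{field,finite} \<Rightarrow> complex"
  assumes \<eta>: "nontrivial_additive_character \<eta>" and three: "(3 :: 'a) = 0"
    and real: "\<And>u. cnj (F u) = F u"
  shows "(norm (measurement_map \<eta> (\<chi> m. F (val_nz m) / of_real r) M))\<^sup>2
    = CARD('a) / r ^ 4 * (\<Sum>d\<in>UNIV. sector_energy F d (sector M d))"
proof -
  let ?\<phi> = "\<chi> m. F (val_nz m) / of_real r"
  let ?c = "\<lambda>l d. \<Sum>s\<in>UNIV. sector M d s * (F (l * (d - s)) * F (l * (- d - s)))"
  have val: "measurement_map \<eta> ?\<phi> M $ (k, l) = (\<Sum>d\<in>UNIV. \<eta> (k * d) * ?c (val_nz l) d) / of_real (r\<^sup>2)" for k l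
  proof -
    define H where "H x y z = z * \<eta> (k * (y - x)) * (F (val_nz l * x) * F (val_nz l * y)) / of_real (r\<^sup>2)" for x y z
    have "measurement_map \<eta> ?\<phi> M $ (k, l) = (\<Sum>m\<in>UNIV. \<Sum>n\<in>UNIV. H (val_nz m) (val_nz n) (M $ m $ n))"
      unfolding measurement_map_def hermitian_inner_def affine_rep_def matrix_vector_mult_def H_def
      by (simp add: sum_distrib_right sum_distrib_left sum_divide_distrib val_mult_nz real
          right_diff_distrib character_diff[OF \<eta>] power2_eq_square mult_ac)
    also have "\<dots> = (\<Sum>d\<in>UNIV. \<Sum>s\<in>UNIV. H (d - s) (- d - s) (sector M d s))"
      by (rule sum_nonzero_pairs[OF three]) (simp add: H_def)
    also have "\<dots> = (\<Sum>d\<in>UNIV. \<eta> (k * d) * ?c (val_nz l) d) / of_real (r\<^sup>2)"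
    proof -
      have "- d - s - (d - s) = - 2 * d" for d s :: 'a
        by (simp add: algebra_simps)
      then have "- d - s - (d - s) = d" for d s :: 'a
        by (simp only: char_3(2)[OF three] mult_1)
      then show ?thesis
        unfolding H_def sum_divide_distrib sum_distrib_left by (simp only: mult_ac)
    qed
    finally show ?thesis .
  qed
  have "(norm (measurement_map \<eta> ?\<phi> M))\<^sup>2
      = (\<Sum>k\<in>UNIV. \<Sum>l\<in>UNIV. (norm (measurement_map \<eta> ?\<phi> M $ (k, l)))\<^sup>2)"
    unfolding norm_vec_square sum.cartesian_product by (simp add: case_prod_unfold)
  also have "\<dots> = (\<Sum>l\<in>UNIV. \<Sum>k\<in>UNIV. (norm (\<Sum>d\<in>UNIV. \<eta> (k * d) * ?c (val_nz l) d))\<^sup>2) / r ^ 4"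
    unfolding val norm_divide power_divide
    by (subst sum.swap) (simp add: sum_divide_distrib norm_power flip: power_mult)
  also have "\<dots> = CARD('a) / r ^ 4 * (\<Sum>l\<in>UNIV. \<Sum>d\<in>UNIV. (norm (?c (val_nz l) d))\<^sup>2)"
    unfolding character_parseval[OF \<eta>] sum_distrib_left[symmetric] by simp
  also have "(\<Sum>l\<in>UNIV. \<Sum>d\<in>UNIV. (norm (?c (val_nz l) d))\<^sup>2) = (\<Sum>d\<in>UNIV. sector_energy F d (sector M d))"
    unfolding sector_energy_def sum_nonzero[of "\<lambda>l. \<Sum>d\<in>UNIV. (norm (?c l d))\<^sup>2"] by (rule sum.swap)
  finally show ?thesis .
qed

section \<open>Extremal vectors\<close>

text \<open>The first vector is \<open>Re z * (x + y) + \<i> * Im z * (x - y)\<close>, and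
  exchanging \<open>x\<close> and \<open>y\<close> flips the sign of its second part, so the
  parallelogram law applies.\<close>

lemma norm_mix_parallelogram:
  fixes z x y :: complex
  shows "(norm (z * x + cnj z * y))\<^sup>2 + (norm (z * y + cnj z * x))\<^sup>2
    = 2 * ((Re z)\<^sup>2 * (norm (x + y))\<^sup>2 + (Im z)\<^sup>2 * (norm (x - y))\<^sup>2)"
  unfolding cmod_power2 by (simp add: power2_eq_square algebra_simps)

text \<open>Grouping \<open>s\<close> with \<open>- s\<close> separates the even and odd parts of
  \<open>v\<close>, weighted by the squares of \<open>Re z\<close> and \<open>Im z\<close>. Each
  position is then counted twice, on both sides.\<close>

lemma sum_norm_mix_ge:
  fixes v :: "'a::{ab_group_add,finite} \<Rightarrow> complex"
  shows "4 * min ((Re z)\<^sup>2) ((Im z)\<^sup>2) * (\<Sum>s\<in>UNIV. (norm (v s))\<^sup>2)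
    \<le> (\<Sum>s\<in>UNIV. (norm (z * v s + cnj z * v (- s)))\<^sup>2)"
proof -
  define m where "m = min ((Re z)\<^sup>2) ((Im z)\<^sup>2)"
  have uminus: "(\<Sum>s\<in>UNIV. f (- s)) = (\<Sum>s\<in>UNIV. f s :: real)" for f :: "'a \<Rightarrow> real"
    by (rule sum.reindex_bij_witness[of _ uminus uminus]) auto
  have pointwise: "4 * m * ((norm (v s))\<^sup>2 + (norm (v (- s)))\<^sup>2)
      \<le> (norm (z * v s + cnj z * v (- s)))\<^sup>2 + (norm (z * v (- s) + cnj z * v (- (- s))))\<^sup>2" for s
  proof -
    have "4 * m * ((norm (v s))\<^sup>2 + (norm (v (- s)))\<^sup>2) = 2 * (m * (2 * ((norm (v s))\<^sup>2 + (norm (v (- s)))\<^sup>2)))"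
      by simp
    also have "2 * ((norm (v s))\<^sup>2 + (norm (v (- s)))\<^sup>2) = (norm (v s + v (- s)))\<^sup>2 + (norm (v s - v (- s)))\<^sup>2"
      unfolding cmod_power2 by (simp add: power2_eq_square algebra_simps)
    also have "2 * (m * ((norm (v s + v (- s)))\<^sup>2 + (norm (v s - v (- s)))\<^sup>2))
        \<le> 2 * ((Re z)\<^sup>2 * (norm (v s + v (- s)))\<^sup>2 + (Im z)\<^sup>2 * (norm (v s - v (- s)))\<^sup>2)"
      unfolding distrib_left[of m] by (intro mult_left_mono add_mono mult_right_mono) (auto simp: m_def)
    finally show ?thesis
      by (simp add: norm_mix_parallelogram)
  qed
  have "4 * m * ((\<Sum>s\<in>UNIV. (norm (v s))\<^sup>2) + (\<Sum>s\<in>UNIV. (norm (v (- s)))\<^sup>2))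
      \<le> (\<Sum>s\<in>UNIV. (norm (z * v s + cnj z * v (- s)))\<^sup>2)
        + (\<Sum>s\<in>UNIV. (norm (z * v (- s) + cnj z * v (- (- s))))\<^sup>2)"
    unfolding sum.distrib[symmetric] sum_distrib_left by (rule sum_mono) (rule pointwise)
  then show ?thesis
    unfolding m_def uminus[of "\<lambda>s. (norm (v s))\<^sup>2"]
      uminus[of "\<lambda>s. (norm (z * v s + cnj z * v (- s)))\<^sup>2"]
    by (simp add: mult_ac)
qed

text \<open>The witness is odd if \<open>Im z\<close> is the smaller part in absolute value and even
  otherwise. Its zero sum will kill the second term of the energy.\<close>

lemma sum_norm_mix_attained:
  fixes d :: "'a::{field,finite}"
  assumes two: "(2 :: 'a) \<noteq> 0" and "d \<noteq> 0" and card: "CARD('a) > 3"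
  obtains v :: "'a \<Rightarrow> complex" where "v d = 0" "v (- d) = 0" "\<exists>s. v s \<noteq> 0" "(\<Sum>s\<in>UNIV. v s) = 0"
    "(\<Sum>s\<in>UNIV. (norm (z * v s + cnj z * v (- s)))\<^sup>2)
      = 4 * min ((Re z)\<^sup>2) ((Im z)\<^sup>2) * (\<Sum>s\<in>UNIV. (norm (v s))\<^sup>2)"
proof -
  have "card {0, d, - d} \<le> 3"
    by (simp add: card_insert_if)
  then have "{0, d, - d} \<noteq> UNIV"
    using card by (metis not_le)
  then obtain a where a: "a \<noteq> 0" "a \<noteq> d" "a \<noteq> - d"
    by blast
  then have a': "- a \<noteq> d" "- a \<noteq> a" "a \<noteq> - a"
    using two by auto
  have neg: "- s = a \<longleftrightarrow> s = - a" for s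
    by auto
  show thesis
  proof (cases "(Im z)\<^sup>2 \<le> (Re z)\<^sup>2")
    case True
    define v :: "'a \<Rightarrow> complex" where "v s = of_bool (s = a) - of_bool (s = - a)" for s
    have "z * v s + cnj z * v (- s) = of_real (2 * Im z) * \<i> * v s" for s
      using a a' by (simp add: v_def complex_eq_iff neg)
    then have "(norm (z * v s + cnj z * v (- s)))\<^sup>2 = 4 * (Im z)\<^sup>2 * (norm (v s))\<^sup>2" for s
      by (simp add: norm_mult power_mult_distrib)
    moreover have "v d = 0" "v (- d) = 0" "v a \<noteq> 0"
      using a a' by (auto simp: v_def)
    moreover have "(\<Sum>s\<in>UNIV. v s) = 0"
      by (simp add: v_def sum_subtractf of_bool_def)
    ultimately show thesis
      using True by (intro that[of v]) (auto simp: sum_distrib_left)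
  next
    case False
    \<comment> \<open>The value \<open>- 2\<close> at 0 makes the sum vanish and keeps
      \<open>v\<close> even; it is compatible with \<open>v d = 0\<close> because
      \<open>d \<noteq> 0\<close>.\<close>
    define v :: "'a \<Rightarrow> complex" where "v s = of_bool (s = a) + of_bool (s = - a) - (if s = 0 then 2 else 0)" for s
    have "z * v s + cnj z * v (- s) = of_real (2 * Re z) * v s" for s
      using a a' by (simp add: v_def complex_eq_iff neg)
    then have "(norm (z * v s + cnj z * v (- s)))\<^sup>2 = 4 * (Re z)\<^sup>2 * (norm (v s))\<^sup>2" for s
      by (simp add: norm_mult power_mult_distrib)
    moreover have "v d = 0" "v (- d) = 0" "v a \<noteq> 0"
      using a a' \<open>d \<noteq> 0\<close> by (auto simp: v_def)
    moreover have "(\<Sum>s\<in>UNIV. v s) = 0"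
      by (simp add: v_def sum.distrib sum_subtractf of_bool_def)
    ultimately show thesis
      using False by (intro that[of v]) (auto simp: sum_distrib_left)
  qed
qed

text \<open>An attained lower bound is the least ratio, which identifies the \<open>LEAST\<close>
  directly.\<close>

lemma sigma_min_square_eqI:
  assumes "\<And>M. c * (norm M)\<^sup>2 \<le> (norm (L M))\<^sup>2"
    and "M\<^sub>0 \<noteq> 0" and "(norm (L M\<^sub>0))\<^sup>2 = c * (norm M\<^sub>0)\<^sup>2"
  shows "(sigma_min L)\<^sup>2 = c"
proof -
  have ratio: "(norm (L M\<^sub>0) / norm M\<^sub>0)\<^sup>2 = c"
    using assms(2,3) by (simp add: power_divide)
  have "sigma_min L = norm (L M\<^sub>0) / norm M\<^sub>0"
    unfolding sigma_min_def
  proof (rule Least_equality)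
    show "\<exists>M. M \<noteq> 0 \<and> norm (L M\<^sub>0) / norm M\<^sub>0 = norm (L M) / norm M"
      using assms(2) by blast
    fix s assume "\<exists>M. M \<noteq> 0 \<and> s = norm (L M) / norm M"
    then obtain M where M: "M \<noteq> 0" "s = norm (L M) / norm M"
      by blast
    then have "c \<le> s\<^sup>2"
      using assms(1)[of M] by (simp add: power_divide pos_le_divide_eq)
    moreover have "0 \<le> s"
      using M by simp
    ultimately show "norm (L M\<^sub>0) / norm M\<^sub>0 \<le> s"
      unfolding ratio[symmetric] by (rule power2_le_imp_le)
  qed
  then show ?thesis
    by (simp add: ratio)
qed

section \<open>Matrices supported on one diagonal\<close>

definition sector_matrix :: "'a \<Rightarrow> ('a::{field,finite} \<Rightarrow> complex) \<Rightarrow> complex ^ 'a nonzero ^ 'a nonzero" where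
  "sector_matrix d v = (\<chi> m n. if val_nz n - val_nz m = d then v (val_nz m + val_nz n) else 0)"

lemma sector_sector_matrix:
  assumes three: "(3 :: 'a::{field,finite}) = 0" and "v d = 0" "v (- d) = (0 :: complex)"
  shows "sector (sector_matrix d v) e s = (if e = (d :: 'a) then v s else 0)"
proof -
  have "- e - s - (e - s) = - 2 * e" "e - s + (- e - s) = - 2 * s"
    by (simp_all add: algebra_simps)
  then have arg: "- e - s - (e - s) = e" "e - s + (- e - s) = s"
    by (simp_all only: char_3(2)[OF three] mult_1)
  show ?thesis
  proof (cases "e - s = 0 \<or> - e - s = 0")
    \<comment> \<open>Here an index is 0: the sector is 0 by convention and \<open>v\<close> by
      assumption.\<close>
    case True
    then have "s = e \<or> s = - e"
      by (auto simp: algebra_simps eq_neg_iff_add_eq_0)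
    then show ?thesis
      using assms(2,3) by (auto simp: sector_boundary)
  next
    case False
    then have "val_nz (Abs_nz (e - s)) = e - s" "val_nz (Abs_nz (- e - s)) = - e - s"
      by (simp_all add: Abs_nz_inverse del: right_minus_eq)
    then show ?thesis
      unfolding sector_def zero_extension_def sector_matrix_def
      using False by (simp only: arg if_False vec_lambda_beta)
  qed
qed

lemma sector_sector_matrix_fun:
  assumes "(3 :: 'a::{field,finite}) = 0" and "v d = 0" "v (- d) = (0 :: complex)"
  shows "sector (sector_matrix d v) e = (if e = (d :: 'a) then v else (\<lambda>_. 0))"
  using sector_sector_matrix[of v d e, OF assms] by auto

lemma norm_sector_matrix_square:
  assumes "(3 :: 'a::{field,finite}) = 0" and "v d = 0" "v (- d) = (0 :: complex)"
  shows "(norm (sector_matrix (d :: 'a) v))\<^sup>2 = (\<Sum>s\<in>UNIV. (norm (v s))\<^sup>2)"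
proof -
  have "(norm (sector_matrix d v))\<^sup>2 = (\<Sum>e\<in>UNIV. if e = d then \<Sum>s\<in>UNIV. (norm (v s))\<^sup>2 else 0)"
    unfolding norm_matrix_square[OF assms(1)] sector_sector_matrix_fun[OF assms]
    by (rule sum.cong[OF refl]) simp
  then show ?thesis
    by simp
qed

lemma sum_sector_energy_sector_matrix:
  assumes "(3 :: 'a::{field,finite}) = 0" and "v d = 0" "v (- d) = (0 :: complex)"
  shows "(\<Sum>e\<in>UNIV. sector_energy F e (sector (sector_matrix d v) e)) = sector_energy F (d :: 'a) v"
proof -
  have "sector_energy F e (sector (sector_matrix d v) e) = (if e = d then sector_energy F d v else 0)" for e
    unfolding sector_sector_matrix_fun[OF assms] by (simp add: sector_energy_def)
  then show ?thesis
    by simp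
qed

text \<open>Since \<open>(2 * Re \<gamma>) ^ 4\<close> is at most
  \<open>2 * 8 * norm \<gamma> ^ 4\<close>, a field of at least 8 elements makes the coefficient of
  the squared sum nonnegative, and that term is dropped.\<close>

lemma sector_energy_ge:
  fixes \<psi> :: "'a::{field,finite} \<Rightarrow> complex"
  assumes "nontrivial_additive_character \<psi>" and "(3 :: 'a) = 0" and card: "CARD('a) \<ge> 8"
    and "v d = 0" "v (- d) = 0"
  shows "CARD('a) * (4 * min ((Re (\<gamma>\<^sup>2))\<^sup>2) ((Im (\<gamma>\<^sup>2))\<^sup>2) * (\<Sum>s\<in>UNIV. (norm (v s))\<^sup>2))
    \<le> sector_energy (real_wave \<gamma> \<psi>) d v"
proof -
  have "(2 * \<bar>Re \<gamma>\<bar>) ^ 4 \<le> (2 * norm \<gamma>) ^ 4"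
    by (intro power_mono mult_left_mono abs_Re_le_cmod) auto
  then have "(2 * Re \<gamma>) ^ 4 \<le> 2 * 8 * norm \<gamma> ^ 4"
    by (simp add: power_mult_distrib)
  also have "\<dots> \<le> (if d = 0 then 4 else 2) * CARD('a) * norm \<gamma> ^ 4"
    using card by (intro mult_right_mono) auto
  finally have coeff: "0 \<le> (if d = 0 then 4 else 2) * CARD('a) * norm \<gamma> ^ 4 - (2 * Re \<gamma>) ^ 4"
    by simp
  have "CARD('a) * (4 * min ((Re (\<gamma>\<^sup>2))\<^sup>2) ((Im (\<gamma>\<^sup>2))\<^sup>2) * (\<Sum>s\<in>UNIV. (norm (v s))\<^sup>2))
      \<le> CARD('a) * (\<Sum>s\<in>UNIV. (norm (\<gamma>\<^sup>2 * v s + cnj (\<gamma>\<^sup>2) * v (- s)))\<^sup>2)"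
    by (intro mult_left_mono sum_norm_mix_ge) simp
  also have "\<dots> \<le> sector_energy (real_wave \<gamma> \<psi>) d v"
    unfolding sector_energy_real_wave[where v = v, OF assms(1,2,4,5)] complex_cnj_power
    by (rule add_increasing2) (intro mult_nonneg_nonneg coeff zero_le_power2, rule order.refl)
  finally show ?thesis .
qed

text \<open>One factor \<open>CARD('a)\<close> comes from Parseval in \<open>k\<close>, the other
  from Parseval in \<open>l\<close>. The bound holds on every diagonal and is attained on the
  diagonal 1.\<close>

theorem sigma_min_real_wave:
  fixes \<eta> \<psi> :: "'a::{field,finite} \<Rightarrow> complex"
  assumes \<eta>: "nontrivial_additive_character \<eta>" and \<psi>: "nontrivial_additive_character \<psi>"
    and three: "(3 :: 'a) = 0" and card: "CARD('a) \<ge> 8"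
  shows "(sigma_min (measurement_map \<eta> (\<chi> m. real_wave \<gamma> \<psi> (val_nz m) / of_real r)))\<^sup>2
    = 4 * (real CARD('a))\<^sup>2 / r ^ 4 * min ((Re (\<gamma>\<^sup>2))\<^sup>2) ((Im (\<gamma>\<^sup>2))\<^sup>2)"
    (is "(sigma_min ?L)\<^sup>2 = ?c")
proof -
  let ?m = "min ((Re (\<gamma>\<^sup>2))\<^sup>2) ((Im (\<gamma>\<^sup>2))\<^sup>2)"
  let ?E = "sector_energy (real_wave \<gamma> \<psi>)"
  have norm_L: "(norm (?L M))\<^sup>2 = CARD('a) / r ^ 4 * (\<Sum>d\<in>UNIV. ?E d (sector M d))" for M
    by (rule norm_measurement_square[OF \<eta> three]) (simp add: real_wave_conv_Re[OF \<psi>])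
  have lower: "?c * (norm M)\<^sup>2 \<le> (norm (?L M))\<^sup>2" for M
  proof -
    have "CARD('a) / r ^ 4 * (\<Sum>d\<in>UNIV. CARD('a) * (4 * ?m * (\<Sum>s\<in>UNIV. (norm (sector M d s))\<^sup>2)))
        \<le> (norm (?L M))\<^sup>2"
      unfolding norm_L
      by (intro mult_left_mono sum_mono sector_energy_ge \<psi> three card sector_boundary) simp
    then show ?thesis
      unfolding norm_matrix_square[OF three] sum_distrib_left[symmetric]
      by (simp add: power2_eq_square mult_ac)
  qed
  have "(1 :: 'a) \<noteq> 0" "CARD('a) > 3"
    using card by simp_all
  with char_3(3)[OF three] obtain v :: "'a \<Rightarrow> complex"
    where v: "v 1 = 0" "v (- 1) = 0" and nonzero: "\<exists>s. v s \<noteq> 0" and sum: "(\<Sum>s\<in>UNIV. v s) = 0"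
      and attained: "(\<Sum>s\<in>UNIV. (norm (\<gamma>\<^sup>2 * v s + cnj (\<gamma>\<^sup>2) * v (- s)))\<^sup>2)
        = 4 * ?m * (\<Sum>s\<in>UNIV. (norm (v s))\<^sup>2)"
    by (rule sum_norm_mix_attained[where d = "1 :: 'a" and z = "\<gamma>\<^sup>2"])
  let ?M = "sector_matrix 1 v"
  note norm_M = norm_sector_matrix_square[of v 1, OF three v]
  have "?M \<noteq> 0"
  proof
    assume "?M = 0"
    then have "(\<Sum>s\<in>UNIV. (norm (v s))\<^sup>2) = 0"
      using norm_M by simp
    then show False
      using nonzero by (simp add: sum_nonneg_eq_0_iff)
  qed
  moreover have "?E 1 v = CARD('a) * (4 * ?m * (\<Sum>s\<in>UNIV. (norm (v s))\<^sup>2))"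
    unfolding sector_energy_real_wave[where v = v, OF \<psi> three v] sum attained[symmetric] by simp
  then have "(norm (?L ?M))\<^sup>2 = ?c * (norm ?M)\<^sup>2"
    unfolding norm_L norm_M sum_sector_energy_sector_matrix[of v 1, OF three v]
    by (simp add: power2_eq_square)
  ultimately show ?thesis
    by (rule sigma_min_square_eqI[OF lower])
qed

text \<open>The matrix is \<open>c\<close> times the sum of \<open>\<alpha>\<close> times the
  identity and \<open>\<beta>\<close> times the outer square of \<open>(1, t)\<close>. Its
  eigenvectors are \<open>(t, - 1)\<close> and \<open>(1, t)\<close>; the signs of \<open>c\<close>
  and \<open>\<beta>\<close> decide which eigenvalue is smaller.\<close>

lemma Min_eigenvalues_rank_one_perturbation:
  fixes \<alpha> \<beta> c t :: real
  assumes "c \<ge> 0" and "\<beta> \<ge> 0"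
  shows "Min (eigenvalues (c *\<^sub>R (vector [vector [\<alpha> + \<beta>, t * \<beta>], vector [t * \<beta>, \<alpha> + t\<^sup>2 * \<beta>]] :: real ^ 2 ^ 2)))
    = c * \<alpha>"
proof -
  let ?A = "c *\<^sub>R (vector [vector [\<alpha> + \<beta>, t * \<beta>], vector [t * \<beta>, \<alpha> + t\<^sup>2 * \<beta>]] :: real ^ 2 ^ 2)"
  let ?\<mu> = "c * (\<alpha> + \<beta> * (1 + t\<^sup>2))"
  have eq: "?A *v v = \<mu> *s v \<longleftrightarrow> c * (\<alpha> * v $ 1 + \<beta> * (v $ 1 + t * v $ 2)) = \<mu> * v $ 1
      \<and> c * (\<alpha> * v $ 2 + t * \<beta> * (v $ 1 + t * v $ 2)) = \<mu> * v $ 2" for v \<mu>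
    by (simp add: vec_eq_iff forall_2 matrix_vector_mult_def sum_2 vector_2 algebra_simps power2_eq_square)
  have "eigenvalues ?A \<subseteq> {c * \<alpha>, ?\<mu>}"
  proof
    fix \<mu> assume "\<mu> \<in> eigenvalues ?A"
    then obtain v :: "real ^ 2" where "v \<noteq> 0"
      and v1: "c * (\<alpha> * v $ 1 + \<beta> * (v $ 1 + t * v $ 2)) = \<mu> * v $ 1"
      and v2: "c * (\<alpha> * v $ 2 + t * \<beta> * (v $ 1 + t * v $ 2)) = \<mu> * v $ 2"
      unfolding eigenvalues_def eq by blast
    show "\<mu> \<in> {c * \<alpha>, ?\<mu>}"
    \<comment> \<open>This is the pairing of \<open>v\<close> with \<open>(1, t)\<close>. If it is
      0, the rank-one part kills \<open>v\<close>; otherwise pairing the eigenvalue equation with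
      \<open>(1, t)\<close> determines \<open>\<mu>\<close>.\<close>
    proof (cases "v $ 1 + t * v $ 2 = 0")
      case True
      then have "c * \<alpha> = \<mu>"
        using v1 v2 \<open>v \<noteq> 0\<close> by (auto simp: vec_eq_iff forall_2)
      then show ?thesis
        by simp
    next
      case False
      have "\<mu> * (v $ 1 + t * v $ 2) = \<mu> * v $ 1 + t * (\<mu> * v $ 2)"
        by (simp add: algebra_simps)
      also have "\<dots> = ?\<mu> * (v $ 1 + t * v $ 2)"
        unfolding v1[symmetric] v2[symmetric] by (simp add: algebra_simps power2_eq_square)
      finally show ?thesis
        using False by simp
    qed
  qed
  moreover have "c * \<alpha> \<in> eigenvalues ?A"
  proof -
    have "?A *v vector [t, - 1] = (c * \<alpha>) *s vector [t, - 1]"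
      unfolding eq by (simp add: vector_2)
    moreover have "(vector [t, - 1] :: real ^ 2) \<noteq> 0"
      by (simp add: vec_eq_iff forall_2 vector_2)
    ultimately show ?thesis
      unfolding eigenvalues_def by blast
  qed
  moreover have "c * \<alpha> \<le> ?\<mu>"
    using assms by (intro mult_left_mono) auto
  ultimately show ?thesis
    by (intro Min_eqI) (auto intro: finite_subset)
qed

section \<open>The explicit formula\<close>

text \<open>On class \<open>j\<close> the character rotates the phase by
  \<open>2 * pi * j / 3\<close>, so the wave is constant there; every class is inhabited, so the
  \<open>THE\<close> is unique.\<close>

lemma trace_class_value_real_wave:
  fixes \<psi> :: "'a::{field,finite} \<Rightarrow> complex"
  assumes card: "CARD('a) = 3 ^ h" and "h > 0" and "j < 3" and \<psi>: "\<psi> = trace_character h"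
  shows "trace_class_value h (real_wave (rcis \<rho> \<theta>) \<psi>) j = 2 * \<rho> * cos (\<theta> + 2 * pi * j / 3)"
proof -
  have at_class: "real_wave (rcis \<rho> \<theta>) \<psi> u = of_real (2 * \<rho> * cos (\<theta> + 2 * pi * j / 3))"
    if "trace_class h u = j" for u
  proof -
    have "rcis \<rho> \<theta> * \<psi> u = rcis \<rho> (\<theta> + 2 * pi * j / 3)"
      unfolding \<psi> trace_character_eq that rcis_def Complex.DeMoivre mult.assoc cis_mult
      by (simp add: mult_ac)
    then show ?thesis
      unfolding \<psi> real_wave_conv_Re[OF nontrivial_trace_character[OF card \<open>h > 0\<close>]] by simp
  qed
  obtain u :: 'a where "trace_class h u = j"
    using trace_class_surj[OF card \<open>h > 0\<close> \<open>j < 3\<close>] by blast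
  with at_class show ?thesis
    unfolding trace_class_value_def by (intro the_equality) (auto simp del: of_real_mult)
qed

theorem theorem6p9:
  fixes q h :: nat
    and \<psi>\<^sub>0 \<psi> F :: "'a::{field,finite} \<Rightarrow> complex"
    and \<gamma> :: complex
    and \<rho> \<theta> a N F0 F1 F2 A B C \<kappa> Q \<mu> :: real
    and \<phi> :: "complex ^ 'a nonzero"
  assumes "h \<ge> 2" and "q = 3 ^ h" and "CARD('a) = q"
    and "nontrivial_additive_character \<psi>\<^sub>0"
    and "\<psi> = trace_character h"
    and "\<rho> > 0" and "\<gamma> = of_real \<rho> * exp (\<i> * of_real \<theta>)"
    and "F = (\<lambda>u. \<gamma> * \<psi> u + cnj \<gamma> * \<psi> (- u))"
    and "F0 = trace_class_value h F 0"
    and "F1 = trace_class_value h F 1"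
    and "F2 = trace_class_value h F 2"
    and "a = real q / 3"
    and "N = 2 * \<rho>^2 * (real q - 2 * (cos \<theta>)^2)"
    and "\<phi> = (\<chi> m. F (val_nz m) / of_real (sqrt N))"
    and "A = a * (F0^4 + F1^4 + F2^4) - F0^4"
    and "B = (a - 1) * F0^4 + 2 * a * F1^2 * F2^2"
    and "C = a / 3 * (F0^2 + F1^2 + F2^2)^2 - F0^4"
    and "\<kappa> = cos (4 * \<theta>)"
    and "Q = 16 * \<rho>^4 * (cos \<theta>)^4"
    and "\<mu> = Min (eigenvalues ((1 / N^2) *\<^sub>R (vector
          [vector [2 * real q * \<rho>^4 * (2 + \<kappa>) - Q,
                   sqrt (real q - 3) * (2 * real q * \<rho>^4 - Q)],
           vector [sqrt (real q - 3) * (2 * real q * \<rho>^4 - Q),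
                   2 * real q * \<rho>^4 * (real q - 2 + \<kappa>) - (real q - 3) * Q]]
          :: real ^ 2 ^ 2)))"
  shows "(sigma_min (measurement_map \<psi>\<^sub>0 \<phi>))^2 =
    real q * Min {(A - C - \<bar>B - C\<bar>) / N^2,
                  4 * real q * \<rho>^4 / N^2 * min ((sin (2 * \<theta>))^2) ((cos (2 * \<theta>))^2),
                  \<mu>}"
proof -
  define m where "m = min ((sin (2 * \<theta>))\<^sup>2) ((cos (2 * \<theta>))\<^sup>2)"
  have card: "CARD('a) = 3 ^ h" and "h > 0"
    using assms(1-3) by auto
  note three = three_eq_0[OF card]
  have \<psi>: "nontrivial_additive_character \<psi>"
    unfolding assms(5) by (rule nontrivial_trace_character[OF card \<open>h > 0\<close>])
  have \<gamma>: "\<gamma> = rcis \<rho> \<theta>"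
    by (simp add: assms(7) rcis_def cis_conv_exp)
  have F: "F = real_wave \<gamma> \<psi>"
    by (simp add: assms(8) real_wave_def fun_eq_iff)
  have "(3::nat) ^ 2 \<le> 3 ^ h"
    using assms(1) by (intro power_increasing) auto
  then have q: "q \<ge> 9"
    by (simp add: assms(2))
  have "(cos \<theta>)\<^sup>2 \<le> 1"
    by (simp add: abs_square_le_1)
  then have "N > 0"
    unfolding assms(13) using q \<open>\<rho> > 0\<close> by (intro mult_pos_pos) auto
  \<comment> \<open>Squaring doubles the phase, which is how the double angles enter.\<close>
  have "\<gamma>\<^sup>2 = rcis (\<rho>\<^sup>2) (2 * \<theta>)"
    by (simp add: \<gamma> DeMoivre2)
  then have "min ((Re (\<gamma>\<^sup>2))\<^sup>2) ((Im (\<gamma>\<^sup>2))\<^sup>2) = \<rho> ^ 4 * m"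
    by (simp add: m_def power_mult_distrib min_mult_distrib_left min.commute flip: power_mult)
  then have sigma: "(sigma_min (measurement_map \<psi>\<^sub>0 \<phi>))\<^sup>2 = 4 * (real q)\<^sup>2 / sqrt N ^ 4 * (\<rho> ^ 4 * m)"
    unfolding assms(14) F using sigma_min_real_wave[OF assms(4) \<psi> three, of \<gamma> "sqrt N"] q assms(3)
    by simp
  have "sqrt N ^ 4 = N\<^sup>2"
    using \<open>N > 0\<close> power_mult[of "sqrt N" 2 2] by simp
  note sigma = sigma[unfolded this]

  define c s where "c = cos \<theta>" and "s = sin \<theta>"
  have cs: "c\<^sup>2 + s\<^sup>2 = 1"
    by (simp add: c_def s_def)
  have F012: "F0 = 2 * \<rho> * c" "F1 = - \<rho> * (c + sqrt 3 * s)" "F2 = - \<rho> * (c - sqrt 3 * s)"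
  proof -
    have "trace_class_value h F j = 2 * \<rho> * cos (\<theta> + 2 * pi * j / 3)" if "j < 3" for j
      unfolding F \<gamma> by (rule trace_class_value_real_wave[OF card \<open>h > 0\<close> that assms(5)])
    note cosines = this[of 0] this[of 1] this[of 2]
    have "cos (2 * pi / 3) = - 1 / 2" "sin (2 * pi / 3) = sqrt 3 / 2"
      by (rule cos_120, rule sin_120)
    moreover have "cos (4 * pi / 3) = - 1 / 2" "sin (4 * pi / 3) = - sqrt 3 / 2"
      using cos_double_cos[of "2 * pi / 3"] sin_double[of "2 * pi / 3"]
      by (simp_all add: cos_120' sin_120' power2_eq_square mult.commute)
    ultimately show "F0 = 2 * \<rho> * c" "F1 = - \<rho> * (c + sqrt 3 * s)" "F2 = - \<rho> * (c - sqrt 3 * s)"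
      using cosines by (simp_all add: assms(9-11) cos_add c_def s_def algebra_simps)
  qed
  have trig: "cos (2 * \<theta>) = c\<^sup>2 - s\<^sup>2" "\<kappa> = (cos (2 * \<theta>))\<^sup>2 - (sin (2 * \<theta>))\<^sup>2"
    using cos_double[of \<theta>] cos_double[of "2 * \<theta>"] by (simp_all add: c_def s_def assms(18))
  have sin2: "(sin (2 * \<theta>))\<^sup>2 = 1 - (cos (2 * \<theta>))\<^sup>2"
    by (simp add: sin_squared_eq)
  have s2: "s\<^sup>2 = 1 - c\<^sup>2"
    using cs by simp
  have "(sqrt 3 * s)\<^sup>2 = 3 * s\<^sup>2"
    by (simp add: power_mult_distrib)
  \<comment> \<open>Changing the sign of \<open>sqrt 3\<close> exchanges \<open>F1\<close> and
    \<open>F2\<close>, so symmetric expressions in them are free of the root.\<close>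
  moreover have "F1\<^sup>2 + F2\<^sup>2 = \<rho>\<^sup>2 * (2 * c\<^sup>2 + 2 * (sqrt 3 * s)\<^sup>2)" "F1 * F2 = \<rho>\<^sup>2 * (c\<^sup>2 - (sqrt 3 * s)\<^sup>2)"
    unfolding F012 by (simp_all only: power2_eq_square) (simp_all only: algebra_simps, simp_all)
  ultimately have symm: "F1\<^sup>2 + F2\<^sup>2 = \<rho>\<^sup>2 * (6 - 4 * c\<^sup>2)" "F1 * F2 = \<rho>\<^sup>2 * (4 * c\<^sup>2 - 3)" "F0\<^sup>2 = 4 * \<rho>\<^sup>2 * c\<^sup>2"
    by (simp_all add: s2 F012 power_mult_distrib algebra_simps)
  have \<kappa>: "\<kappa> = 2 * (2 * c\<^sup>2 - 1)\<^sup>2 - 1"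
    by (simp add: trig sin2 s2)
  have squares: "F0\<^sup>2 + F1\<^sup>2 + F2\<^sup>2 = 6 * \<rho>\<^sup>2"
    using symm by (simp add: algebra_simps)
  have fourth: "F0 ^ 4 + F1 ^ 4 + F2 ^ 4 = 18 * \<rho> ^ 4"
  proof -
    have "F0 ^ 4 + F1 ^ 4 + F2 ^ 4 = (F0\<^sup>2)\<^sup>2 + (F1\<^sup>2 + F2\<^sup>2)\<^sup>2 - 2 * (F1 * F2)\<^sup>2"
      by algebra
    also have "\<dots> = 18 * \<rho> ^ 4"
      unfolding symm by algebra
    finally show ?thesis .
  qed
  have mixed: "F0 ^ 4 + 2 * F1\<^sup>2 * F2\<^sup>2 = 12 * \<rho> ^ 4 + 6 * \<rho> ^ 4 * \<kappa>"
  proof -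
    have "F0 ^ 4 + 2 * F1\<^sup>2 * F2\<^sup>2 = (F0\<^sup>2)\<^sup>2 + 2 * (F1 * F2)\<^sup>2"
      by algebra
    also have "\<dots> = 12 * \<rho> ^ 4 + 6 * \<rho> ^ 4 * \<kappa>"
      unfolding symm \<kappa> by algebra
    finally show ?thesis .
  qed
  \<comment> \<open>The terms \<open>- F0 ^ 4\<close> cancel, leaving
    \<open>18 * a - 12 * a = 2 * q\<close> times \<open>\<rho> ^ 4\<close>.\<close>
  have AC: "A - C = 2 * q * \<rho> ^ 4"
    unfolding assms(15,17) fourth squares by (simp add: assms(12) power_mult_distrib flip: power_mult)
  have BC: "B - C = 2 * q * \<rho> ^ 4 * \<kappa>"
  proof -
    have "B = a * (F0 ^ 4 + 2 * F1\<^sup>2 * F2\<^sup>2) - F0 ^ 4"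
      by (simp add: assms(16) algebra_simps)
    then show ?thesis
      unfolding mixed assms(17) squares
      by (simp add: assms(12) power_mult_distrib algebra_simps flip: power_mult)
  qed
  have abs_BC: "\<bar>B - C\<bar> = 2 * q * \<rho> ^ 4 * \<bar>\<kappa>\<bar>"
    using \<open>\<rho> > 0\<close> by (simp add: BC abs_mult)
  \<comment> \<open>\<open>\<kappa>\<close> is the difference of two nonnegative numbers with sum 1,
    and \<open>m\<close> is the smaller one.\<close>
  have abs_\<kappa>: "1 - \<bar>\<kappa>\<bar> = 2 * m"
    by (simp add: trig(2) m_def sin2 min_def abs_if)
  have first: "(A - C - \<bar>B - C\<bar>) / N\<^sup>2 = 4 * q * \<rho> ^ 4 / N\<^sup>2 * m"
  proof -
    have "A - C - \<bar>B - C\<bar> = 2 * q * \<rho> ^ 4 * (1 - \<bar>\<kappa>\<bar>)"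
      unfolding AC abs_BC by (simp add: algebra_simps)
    then show ?thesis
      by (simp add: abs_\<kappa>)
  qed
  have third: "\<mu> = 4 * q * \<rho> ^ 4 / N\<^sup>2 * (cos (2 * \<theta>))\<^sup>2"
  proof -
    \<comment> \<open>Scalar and rank-one parts of the matrix, with
      \<open>t = sqrt (real q - 3)\<close>; moreover \<open>1 + \<kappa>\<close> is twice the square
      of \<open>cos (2 * \<theta>)\<close>.\<close>
    define \<alpha> \<beta> where "\<alpha> = 2 * real q * \<rho> ^ 4 * (1 + \<kappa>)" and "\<beta> = 2 * real q * \<rho> ^ 4 - Q"
    have "(cos \<theta>) ^ 4 \<le> 1"
      using power_le_one[of "(cos \<theta>)\<^sup>2" 2] \<open>(cos \<theta>)\<^sup>2 \<le> 1\<close> by (simp flip: power_mult)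
    then have "Q \<le> 16 * \<rho> ^ 4"
      using \<open>\<rho> > 0\<close> by (simp add: assms(19))
    also have "\<dots> \<le> 2 * real q * \<rho> ^ 4"
      using q \<open>\<rho> > 0\<close> by (intro mult_right_mono) auto
    finally have "\<beta> \<ge> 0"
      by (simp add: \<beta>_def)
    have entries: "2 * real q * \<rho>^4 * (2 + \<kappa>) - Q = \<alpha> + \<beta>"
      "2 * real q * \<rho>^4 * (real q - 2 + \<kappa>) - (real q - 3) * Q = \<alpha> + (sqrt (real q - 3))\<^sup>2 * \<beta>"
      using q by (simp_all add: \<alpha>_def \<beta>_def algebra_simps)
    have "\<mu> = 1 / N\<^sup>2 * \<alpha>"
      unfolding assms(20) entries unfolding \<beta>_def[symmetric]
      by (rule Min_eigenvalues_rank_one_perturbation) (use \<open>\<beta> \<ge> 0\<close> in auto)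
    then show ?thesis
      by (simp add: \<alpha>_def trig(2) sin2)
  qed
  have "4 * q * \<rho> ^ 4 / N\<^sup>2 * m \<le> \<mu>"
    unfolding third using \<open>\<rho> > 0\<close> by (intro mult_left_mono) (auto simp: m_def)
  then have "Min {4 * q * \<rho> ^ 4 / N\<^sup>2 * m, 4 * q * \<rho> ^ 4 / N\<^sup>2 * m, \<mu>} = 4 * q * \<rho> ^ 4 / N\<^sup>2 * m"
    by simp
  then show ?thesis
    unfolding sigma m_def[symmetric] first by (simp add: power2_eq_square)
qed

end
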